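(* Let $X$ be a splittable random process, and let $\sigma\in[0,\infty)$ be defined by \[ \frac{\sigma^2}{2}=\lim_{\substack{r\to\infty,\ \lambda\to 0\\ \lambda\log r\to 0}} \frac{1}{r\lambda^2}\log \mathbb{E}\exp\Big(\lambda\int_0^r X_t\,dt\Big). \] Then the distribution of $r^{-1/2}\int_0^rX_t\,dt$ converges (weakly, as $r\to\infty$) to the normal distribution $N(0,\sigma^2)$.
   Context: A (random) process $X$ is a two-parameter family of real random variables on a probability space, denoted $\big(\int_\alpha^\beta X_t\,dt\big)_{-\infty<\alpha<\beta<\infty}$ (only a notation; no individual random variables $X_t$ are required to exist), satisfying $\int_\alpha^\beta X_t\,dt+\int_\beta^\gamma X_t\,dt=\int_\alpha^\gamma X_t\,dt$ for $\alpha<\beta<\gamma$. Two processes $X,Y$ (possibly on different probability spaces) are identically distributed if the random vectors $\big(\int_{\alpha_1}^{\beta_1}X_t\,dt,\dots,\int_{\alpha_n}^{\beta_n}X_t\,dt\big)$ and $\big(\int_{\alpha_1}^{\beta_1}Y_t\,dt,\dots,\int_{\alpha_n}^{\beta_n}Y_t\,dt\big)$ are identically distributed whenever $\alpha_1<\beta_1,\dots,\alpha_n<\beta_n$. The process is stationary if time shifts, sending $\int_\alpha^\beta X_t\,dt$ to $\int_{\alpha+s}^{\beta+s}X_t\,dt$, are measure preserving (the shifted process is distributed like $X$ for every $s\in\mathbb{R}$). It is centered if $\mathbb{E}\big|\int_\alpha^\beta X_t\,dt\big|<\infty$ and $\mathbb{E}\int_\alpha^\beta X_t\,dt=0$ for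 all $\alpha<\beta$. The measurability condition is: $r\mapsto\mathbb{E}\,\varphi\big(\int_0^rX_t\,dt\big)$ is a measurable function of $r\in(0,\infty)$ for every bounded continuous $\varphi:\mathbb{R}\to\mathbb{R}$. The $\sigma$-field generated by a process is the one generated by all $\int_\alpha^\beta X_t\,dt$; independence of processes means independence of the generated $\sigma$-fields. A centered stationary process $X$ satisfying the measurability condition is splittable if there exist $r>0$ and $\varepsilon>0$ such that $\mathbb{E}\exp\big(\varepsilon\big|\int_0^rX_t\,dt\big|\big)<\infty$, and there exists (on some probability space) a triple of processes $X^0,X^-,X^+$ such that (a) the two processes $X^-,X^+$ are independent; (b) the four processes $X,X^0,X^-,X^+$ are identically distributed; (c) there exists a number $c>0$ such that for all $a,b>0$, \[ \mathbb{E}\exp\Big(c\Big|\int_{-a}^0X^-_t\,dt-\int_{-a}^0X^0_t\,dt\Big|+c\Big|\int_0^bX^+_t\,dt-\int_0^bX^0_t\,dt\Big|\Big)\le 2 . \] For every splittable process the limit defining $\sigma^2/2$ exists in $[0,\infty)$, in the following sense: for every $\varepsilon>0$ there exist $R$ and $\delta>0$ such that $\frac{1}{r\lambda^2}\log \mathbb{E}\exp(\lambda\int_0^r X_t\,dt)$ is within $\varepsilon$ of the limit for all $r\ge R$ and all $\lambda\ne0$ with $|\lambda|\log r\le\delta$. The distribution $N(0,0)$ is the unit mass at $0$. *)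

theory Defs
  imports "HOL-Probability.Probability"
begin

section \<open>Random processes\<close>

text \<open>
  A process assigns to each pair \<open>\<alpha> < \<beta>\<close> a random variable, written X \<alpha> \<beta>, that stands for the
  formal integral of the process over the interval from \<open>\<alpha>\<close> to \<open>\<beta>\<close>. The values for
  \<open>\<alpha> \<ge> \<beta>\<close> are junk and are never constrained.
\<close>

type_synonym 'a process = "real \<Rightarrow> real \<Rightarrow> 'a \<Rightarrow> real"

text \<open>
  Equality of random variables means equality almost everywhere.
\<close>

definition random_process :: "'a measure \<Rightarrow> 'a process \<Rightarrow> bool" where
  "random_process M X \<longleftrightarrow>
     prob_space M \<and>
     (\<forall>\<alpha> \<beta>. \<alpha> < \<beta> \<longrightarrow> X \<alpha> \<beta> \<in> borel_measurable M) \<and>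
     (\<forall>\<alpha> \<beta> \<gamma>. \<alpha> < \<beta> \<longrightarrow> \<beta> < \<gamma> \<longrightarrow> (AE \<omega> in M. X \<alpha> \<beta> \<omega> + X \<beta> \<gamma> \<omega> = X \<alpha> \<gamma> \<omega>))"

definition identically_distributed ::
  "'a measure \<Rightarrow> 'a process \<Rightarrow> 'b measure \<Rightarrow> 'b process \<Rightarrow> bool" where
  "identically_distributed M X N Y \<longleftrightarrow>
     (\<forall>(n::nat) \<alpha> \<beta>. (\<forall>i<n. \<alpha> i < \<beta> i) \<longrightarrow>
        distr M (PiM {..<n} (\<lambda>_. borel)) (\<lambda>\<omega>. \<lambda>i\<in>{..<n}. X (\<alpha> i) (\<beta> i) \<omega>) =
        distr N (PiM {..<n} (\<lambda>_. borel)) (\<lambda>\<omega>. \<lambda>i\<in>{..<n}. Y (\<alpha> i) (\<beta> i) \<omega>))"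

definition stationary_process :: "'a measure \<Rightarrow> 'a process \<Rightarrow> bool" where
  "stationary_process M X \<longleftrightarrow>
     (\<forall>s. identically_distributed M (\<lambda>\<alpha> \<beta>. X (\<alpha> + s) (\<beta> + s)) M X)"

definition centered_process :: "'a measure \<Rightarrow> 'a process \<Rightarrow> bool" where
  "centered_process M X \<longleftrightarrow>
     (\<forall>\<alpha> \<beta>. \<alpha> < \<beta> \<longrightarrow> integrable M (X \<alpha> \<beta>) \<and> (\<integral>\<omega>. X \<alpha> \<beta> \<omega> \<partial>M) = 0)"

text \<open>
  Measurability in \<open>r\<close> is taken in the sense of Lebesgue, the weaker of the two usual requirements.
\<close>

definition measurability_condition :: "'a measure \<Rightarrow> 'a process \<Rightarrow> bool" where
  "measurability_condition M X \<longleftrightarrow>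
     (\<forall>\<phi> :: real \<Rightarrow> real. continuous_on UNIV \<phi> \<longrightarrow> bounded (range \<phi>) \<longrightarrow>
        (\<lambda>r. \<integral>\<omega>. \<phi> (X 0 r \<omega>) \<partial>M) \<in> borel_measurable (lebesgue_on {0<..}))"

definition process_sigma_field :: "'a measure \<Rightarrow> 'a process \<Rightarrow> 'a set set" where
  "process_sigma_field M X =
     sigma_sets (space M) {X \<alpha> \<beta> -` A \<inter> space M | \<alpha> \<beta> A. \<alpha> < \<beta> \<and> A \<in> sets borel}"

definition independent_processes :: "'a measure \<Rightarrow> 'a process \<Rightarrow> 'a process \<Rightarrow> bool" where
  "independent_processes M X Y \<longleftrightarrow>
     prob_space.indep_set M (process_sigma_field M X) (process_sigma_field M Y)"


section \<open>Splittable processes\<close>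

text \<open>
  HOL cannot quantify over types inside a formula, so the type that carries the probability space
  of the triple is a parameter. In a theorem that assumes splittable TYPE('b) M X with \<open>'b\<close>
  a type variable not occurring in the conclusion, the implicit universal quantification over
  \<open>'b\<close> in the hypothesis amounts to the existence of the triple on some probability space.

  Expectations that may be infinite are nonnegative Lebesgue integrals.
\<close>

definition splittable :: "'b itself \<Rightarrow> 'a measure \<Rightarrow> 'a process \<Rightarrow> bool" where
  "splittable (_ :: 'b itself) M X \<longleftrightarrow>
     random_process M X \<and> centered_process M X \<and> stationary_process M X \<and>
     measurability_condition M X \<and>
     (\<exists>r>0. \<exists>\<epsilon>>0. (\<integral>\<^sup>+\<omega>. ennreal (exp (\<epsilon> * \<bar>X 0 r \<omega>\<bar>)) \<partial>M) < \<infinity>) \<and>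
     (\<exists>(N :: 'b measure) X0 Xm Xp.
        random_process N X0 \<and> random_process N Xm \<and> random_process N Xp \<and>
        independent_processes N Xm Xp \<and>
        identically_distributed M X N X0 \<and>
        identically_distributed M X N Xm \<and>
        identically_distributed M X N Xp \<and>
        (\<exists>c>0. \<forall>a>0. \<forall>b>0.
           (\<integral>\<^sup>+\<omega>. ennreal (exp (c * \<bar>Xm (- a) 0 \<omega> - X0 (- a) 0 \<omega>\<bar> +
                               c * \<bar>Xp 0 b \<omega> - X0 0 b \<omega>\<bar>)) \<partial>N) \<le> 2))"


section \<open>The limit defining the variance\<close>

text \<open>
  With \<open>\<theta>\<close> for the parameter usually called lambda, the limit of
  \<open>log E exp (\<theta> X 0 r) / (r \<theta>\<^sup>2)\<close> as \<open>r\<close> tends to infinity, \<open>\<theta>\<close> tends to 0 and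
  \<open>\<theta> log r\<close> tends to 0. The finiteness clause is part of the requirement that the quotient be close
  to the real number \<open>L\<close>; it has to be explicit because the Bochner integral of a function that is
  not integrable is 0.
\<close>

definition log_mgf_limit :: "'a measure \<Rightarrow> 'a process \<Rightarrow> real \<Rightarrow> bool" where
  "log_mgf_limit M X L \<longleftrightarrow>
     (\<forall>\<epsilon>>0. \<exists>R>0. \<exists>\<delta>>0. \<forall>r\<ge>R. \<forall>\<theta>. \<theta> \<noteq> 0 \<and> \<bar>\<theta>\<bar> * ln r \<le> \<delta> \<longrightarrow>
        integrable M (\<lambda>\<omega>. exp (\<theta> * X 0 r \<omega>)) \<and>
        \<bar>1 / (r * \<theta>\<^sup>2) * ln (\<integral>\<omega>. exp (\<theta> * X 0 r \<omega>) \<partial>M) - L\<bar> \<le> \<epsilon>)"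


section \<open>Normal distributions and weak convergence\<close>

text \<open>
  The second parameter is the standard deviation, as for \<^const>\<open>normal_density\<close>, which is 0
  everywhere when that parameter is 0; hence the separate degenerate case.
\<close>

definition normal_distribution :: "real \<Rightarrow> real \<Rightarrow> real measure" where
  "normal_distribution \<mu> \<sigma> =
     (if \<sigma> = 0 then return borel \<mu>
      else density lborel (\<lambda>x. ennreal (normal_density \<mu> \<sigma> x)))"

text \<open>
  The predicate \<^const>\<open>weak_conv_m\<close> covers only sequences of distributions; the following one is
  for families with an arbitrary index filter.
\<close>

definition weakly_converges :: "('i \<Rightarrow> real measure) \<Rightarrow> real measure \<Rightarrow> 'i filter \<Rightarrow> bool" where
  "weakly_converges \<nu> \<mu> F \<longleftrightarrow>
     (\<forall>f :: real \<Rightarrow> real. continuous_on UNIV f \<longrightarrow> bounded (range f) \<longrightarrow>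
        ((\<lambda>i. \<integral>x. f x \<partial>\<nu> i) \<longlongrightarrow> (\<integral>x. f x \<partial>\<mu>)) F)"

lemma weakly_converges_sequentially_iff:
  assumes "\<And>n. real_distribution (\<nu> n)" "real_distribution \<mu>"
  shows "weakly_converges \<nu> \<mu> sequentially \<longleftrightarrow> weak_conv_m \<nu> \<mu>"
proof
  assume W: "weakly_converges \<nu> \<mu> sequentially"
  show "weak_conv_m \<nu> \<mu>"
  proof (rule integral_bdd_continuous_conv_imp_weak_conv[OF assms])
    fix f :: "real \<Rightarrow> real"
    assume f: "\<And>x. isCont f x" "\<And>x. \<bar>f x\<bar> \<le> 1"
    have "continuous_on UNIV f"
      using f(1) by (simp add: continuous_at_imp_continuous_on)
    moreover have "bounded (range f)"
      using f(2) by (auto simp: bounded_iff intro!: exI[of _ 1])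
    ultimately show "(\<lambda>n. \<integral>x. f x \<partial>\<nu> n) \<longlonglongrightarrow> (\<integral>x. f x \<partial>\<mu>)"
      using W unfolding weakly_converges_def by blast
  qed
next
  assume W: "weak_conv_m \<nu> \<mu>"
  show "weakly_converges \<nu> \<mu> sequentially"
    unfolding weakly_converges_def
  proof (intro allI impI)
    fix f :: "real \<Rightarrow> real"
    assume f: "continuous_on UNIV f" "bounded (range f)"
    then obtain B where "\<And>x. norm (f x) \<le> B"
      by (auto simp: bounded_iff)
    moreover have "isCont f x" for x
      using f(1) by (simp add: continuous_on_eq_continuous_at)
    ultimately show "(\<lambda>n. \<integral>x. f x \<partial>\<nu> n) \<longlonglongrightarrow> (\<integral>x. f x \<partial>\<mu>)"
      by (intro weak_conv_imp_integral_bdd_continuous_conv[OF assms W])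
  qed
qed

lemma real_distribution_normal_distribution:
  assumes "\<sigma> \<ge> 0"
  shows "real_distribution (normal_distribution \<mu> \<sigma>)"
  using assms prob_space_normal_density[of \<sigma> \<mu>]
  by (auto simp: normal_distribution_def real_distribution_def real_distribution_axioms_def
      intro: prob_space_return)

end

theory Submission
  imports Defs "HOL-Real_Asymp.Real_Asymp"
begin

text \<open>
  Substituting \<open>s / sqrt r\<close> for the parameter of the log-Laplace limit shows that the moment
  generating functions of the normalized integrals converge pointwise on the whole line to that of
  the normal distribution, so the result follows from Curtiss' theorem. For the latter, the moments
  over factorials are the Taylor coefficients of the moment generating functions and are uniformly
  geometrically bounded; pointwise convergence of the power series therefore forces convergence of
  every coefficient, and evaluating the same series at imaginary arguments gives convergence of the
  characteristic functions.
\<close>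

section \<open>Coefficients of power series that tend to zero pointwise\<close>

lemma summable_bounded_coeff_geometric:
  fixes e :: "nat \<Rightarrow> real"
  assumes "\<And>k. \<bar>e k\<bar> \<le> C" "0 < s" "s < 1"
  shows "summable (\<lambda>k. e k * s ^ k)"
  by (rule summable_comparison_test'[where N=0 and g="\<lambda>k. C * s ^ k"])
    (use assms in \<open>auto intro!: summable_mult summable_geometric mult_right_mono simp: abs_mult\<close>)

text \<open>The terms after the constant one contribute at most \<open>C * s / (1 - s)\<close>,
  whatever the index. Fixing a small \<open>s\<close> first and only then passing to the limit along
  \<open>F\<close> isolates the constant coefficient.\<close>

lemma coeff_0_tendsto_0_of_power_series_tendsto_0:
  fixes d :: "'i \<Rightarrow> nat \<Rightarrow> real"
  assumes bnd: "eventually (\<lambda>n. \<forall>k. \<bar>d n k\<bar> \<le> C) F"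
    and lim: "\<And>s. 0 < s \<Longrightarrow> s < 1 \<Longrightarrow> ((\<lambda>n. \<Sum>k. d n k * s ^ k) \<longlongrightarrow> 0) F"
  shows "((\<lambda>n. d n 0) \<longlongrightarrow> 0) F"
proof (rule tendstoI)
  fix \<epsilon> :: real
  assume \<epsilon>: "0 < \<epsilon>"
  have "((\<lambda>s. C * s / (1 - s)) \<longlongrightarrow> C * 0 / (1 - 0)) (at_right 0)"
    by (intro tendsto_intros) auto
  then have "eventually (\<lambda>s. C * s / (1 - s) < \<epsilon> / 2) (at_right 0)"
    using \<epsilon> by (intro order_tendstoD(2)) auto
  moreover have "eventually (\<lambda>s::real. 0 < s \<and> s < 1) (at_right 0)"
    by (auto simp: eventually_at_right_field intro!: exI[of _ 1])
  ultimately have "eventually (\<lambda>s. C * s / (1 - s) < \<epsilon> / 2 \<and> 0 < s \<and> s < 1) (at_right 0)"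
    by eventually_elim auto
  then obtain s where s: "C * s / (1 - s) < \<epsilon> / 2" "0 < s" "s < 1"
    using eventually_happens'[of "at_right (0::real)"] by auto
  have "eventually (\<lambda>n. dist (\<Sum>k. d n k * s ^ k) 0 < \<epsilon> / 2) F"
    using lim[OF s(2,3)] \<epsilon> by (intro tendstoD) auto
  with bnd show "eventually (\<lambda>n. dist (d n 0) 0 < \<epsilon>) F"
  proof eventually_elim
    case (elim n)
    have "\<bar>\<Sum>k. d n (Suc k) * s ^ k\<bar> \<le> (\<Sum>k. C * s ^ k)"
      by (rule norm_suminf_le[where 'a=real, unfolded real_norm_def])
        (use elim s in \<open>auto intro!: summable_mult summable_geometric mult_right_mono simp: abs_mult\<close>)
    also have "\<dots> = C / (1 - s)"
      using s by (subst suminf_mult) (auto simp: suminf_geometric summable_geometric)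
    finally have "\<bar>\<Sum>k. d n (Suc k) * s ^ k\<bar> * s \<le> C / (1 - s) * s"
      using s by (intro mult_right_mono) auto
    then have "\<bar>(\<Sum>k. d n (Suc k) * s ^ k) * s\<bar> \<le> C * s / (1 - s)"
      using s by (simp add: abs_mult)
    moreover have "(\<Sum>k. d n k * s ^ k) = d n 0 + (\<Sum>k. d n (Suc k) * s ^ k) * s"
      using elim s by (intro powser_split_head(1) summable_bounded_coeff_geometric) auto
    ultimately show ?case
      using elim(2) s(1) unfolding dist_real_def by linarith
  qed
qed

text \<open>Induction on \<open>k\<close> for all families at once: subtracting the constant term,
  which tends to 0 by the previous lemma, and dividing by \<open>s\<close> gives the series of the
  shifted coefficients, with the same bound \<open>C\<close>.\<close>

lemma coeff_tendsto_0_of_power_series_tendsto_0: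
  fixes d :: "'i \<Rightarrow> nat \<Rightarrow> real"
  assumes "eventually (\<lambda>n. \<forall>k. \<bar>d n k\<bar> \<le> C) F"
    and "\<And>s. 0 < s \<Longrightarrow> s < 1 \<Longrightarrow> ((\<lambda>n. \<Sum>k. d n k * s ^ k) \<longlongrightarrow> 0) F"
  shows "((\<lambda>n. d n k) \<longlongrightarrow> 0) F"
  using assms
proof (induction k arbitrary: d)
  case 0
  then show ?case
    by (rule coeff_0_tendsto_0_of_power_series_tendsto_0)
next
  case (Suc k)
  show ?case
  proof (rule Suc.IH)
    show "eventually (\<lambda>n. \<forall>k. \<bar>d n (Suc k)\<bar> \<le> C) F"
      using Suc.prems(1) by eventually_elim auto
    fix s :: real
    assume s: "0 < s" "s < 1"
    have "((\<lambda>n. ((\<Sum>k. d n k * s ^ k) - d n 0) / s) \<longlongrightarrow> (0 - 0) / s) F"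
      using s Suc.prems
      by (intro tendsto_intros coeff_0_tendsto_0_of_power_series_tendsto_0[of d C]) auto
    moreover have "eventually (\<lambda>n. ((\<Sum>k. d n k * s ^ k) - d n 0) / s
        = (\<Sum>k. d n (Suc k) * s ^ k)) F"
      using Suc.prems(1)
    proof eventually_elim
      case (elim n)
      have "(\<Sum>k. d n k * s ^ k) = d n 0 + (\<Sum>k. d n (Suc k) * s ^ k) * s"
        using elim s by (intro powser_split_head(1) summable_bounded_coeff_geometric) auto
      then show ?case
        using s by (simp add: field_simps)
    qed
    ultimately show "((\<lambda>n. \<Sum>k. d n (Suc k) * s ^ k) \<longlongrightarrow> 0) F"
      by (simp add: tendsto_cong)
  qed
qed

section \<open>Moments and the Taylor series of exponential transforms\<close>

lemma power_le_fact_mult_exp: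
  fixes x :: real
  assumes "0 \<le> x"
  shows "x ^ k / fact k \<le> exp x"
proof -
  \<comment> \<open>A one-element partial sum: since all terms are nonnegative, a single term is
    bounded by the whole exponential series.\<close>
  have "(\<Sum>n\<in>{k}. x ^ n /\<^sub>R fact n) \<le> (\<Sum>n. x ^ n /\<^sub>R fact n)"
    using assms by (intro sum_le_suminf summable_exp_generic) auto
  then show ?thesis
    by (simp add: exp_def field_simps)
qed

text \<open>Supplies a majorant independent of \<open>n\<close> for integrating the exponential
  series term by term.\<close>

lemma norm_exp_partial_sum_le:
  fixes z :: complex
  shows "norm (\<Sum>k<n. z ^ k /\<^sub>R fact k) \<le> exp (norm z)"
proof -
  have "norm (\<Sum>k<n. z ^ k /\<^sub>R fact k) \<le> (\<Sum>k<n. norm z ^ k /\<^sub>R fact k)"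
    by (rule order_trans[OF norm_sum]) (simp add: norm_power)
  also have "\<dots> \<le> exp (norm z)"
    unfolding exp_def by (intro sum_le_suminf summable_exp_generic) auto
  finally show ?thesis .
qed

context real_distribution
begin

lemma integrable_power_of_integrable_exp:
  assumes "integrable M (\<lambda>x. exp (S * \<bar>x\<bar>))" "0 < S"
  shows "integrable M (\<lambda>x. x ^ k)"
proof (rule Bochner_Integration.integrable_bound)
  show "integrable M (\<lambda>x. fact k / S ^ k * exp (S * \<bar>x\<bar>))"
    using assms(1) by simp
  show "AE x in M. norm (x ^ k) \<le> norm (fact k / S ^ k * exp (S * \<bar>x\<bar>))"
  proof (rule AE_I2)
    fix x
    show "norm (x ^ k) \<le> norm (fact k / S ^ k * exp (S * \<bar>x\<bar>))"
      using power_le_fact_mult_exp[of "S * \<bar>x\<bar>" k] assms(2)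
      by (simp add: field_simps power_mult_distrib power_abs abs_mult)
  qed
qed simp

text \<open>The bound does not depend on \<open>k\<close>: the factor \<open>S ^ k\<close> turns the
  geometric decay of the Taylor coefficients into plain boundedness, as the coefficient lemmas
  require.\<close>

lemma scaled_moment_le:
  assumes "integrable M (\<lambda>x. exp (S * \<bar>x\<bar>))" "0 < S"
  shows "\<bar>expectation (\<lambda>x. x ^ k) / fact k * S ^ k\<bar> \<le> expectation (\<lambda>x. exp (S * \<bar>x\<bar>))"
proof -
  have "expectation (\<lambda>x. x ^ k) / fact k * S ^ k = expectation (\<lambda>x. S ^ k / fact k * x ^ k)"
    by simp
  also have "\<bar>\<dots>\<bar> \<le> expectation (\<lambda>x. exp (S * \<bar>x\<bar>))"
  proof (rule order_trans[OF integral_abs_bound], rule integral_mono)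
    fix x
    show "\<bar>S ^ k / fact k * x ^ k\<bar> \<le> exp (S * \<bar>x\<bar>)"
      using power_le_fact_mult_exp[of "S * \<bar>x\<bar>" k] assms(2)
      by (simp add: field_simps power_mult_distrib power_abs abs_mult)
  qed (use assms integrable_power_of_integrable_exp in auto)
  finally show ?thesis .
qed

text \<open>Dominated convergence with majorant \<open>exp (S * \<bar>x\<bar>)\<close>. Complex
  \<open>z\<close> lets one series represent both the moment generating function and the
  characteristic function.\<close>

lemma sums_expectation_exp:
  fixes z :: complex
  assumes "integrable M (\<lambda>x. exp (S * \<bar>x\<bar>))" "0 < S" "norm z \<le> S"
  shows "(\<lambda>k. of_real (expectation (\<lambda>x. x ^ k) / fact k) * z ^ k)
    sums (CLINT x|M. exp (z * of_real x))"
proof -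
  have int: "integrable M (\<lambda>x. x ^ k)" for k
    using assms integrable_power_of_integrable_exp by blast
  have "(\<lambda>n. CLINT x|M. (\<Sum>k<n. (z * of_real x) ^ k /\<^sub>R fact k))
      \<longlonglongrightarrow> (CLINT x|M. exp (z * of_real x))"
  proof (rule integral_dominated_convergence)
    show "AE x in M. norm (\<Sum>k<n. (z * of_real x) ^ k /\<^sub>R fact k) \<le> exp (S * \<bar>x\<bar>)" for n
    proof (rule AE_I2)
      fix x
      have "norm (\<Sum>k<n. (z * of_real x) ^ k /\<^sub>R fact k) \<le> exp (norm (z * of_real x))"
        by (rule norm_exp_partial_sum_le)
      also have "\<dots> \<le> exp (S * \<bar>x\<bar>)"
        using assms(3) by (auto simp: norm_mult intro!: mult_right_mono)
      finally show "norm (\<Sum>k<n. (z * of_real x) ^ k /\<^sub>R fact k) \<le> exp (S * \<bar>x\<bar>)" .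
    qed
    show "AE x in M. (\<lambda>n. \<Sum>k<n. (z * of_real x) ^ k /\<^sub>R fact k) \<longlonglongrightarrow> exp (z * of_real x)"
      using exp_converges[where 'a=complex] by (auto simp: sums_def)
  qed (use assms(1) in measurable)
  moreover have "(CLINT x|M. (\<Sum>k<n. (z * of_real x) ^ k /\<^sub>R fact k))
      = (\<Sum>k<n. of_real (expectation (\<lambda>x. x ^ k) / fact k) * z ^ k)" for n
  proof -
    \<comment> \<open>Only the real power \<open>x ^ k\<close> is left under the coercion, so its
      complex integral is the coerced real moment.\<close>
    have eq: "(z * of_real x) ^ k /\<^sub>R fact k = z ^ k / fact k * of_real (x ^ k)" for k and x :: real
      by (simp add: power_mult_distrib scaleR_conv_of_real field_simps)
    show ?thesis
      unfolding eq using int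
      by (subst Bochner_Integration.integral_sum)
        (auto intro!: sum.cong integrable_mult_right simp del: of_real_power)
  qed
  ultimately show ?thesis
    by (simp add: sums_def)
qed

text \<open>At each point \<open>exp (S * \<bar>x\<bar>)\<close> equals one of the two positive
  exponentials. The resulting bound involves only values of the moment generating function, whose
  limits are known.\<close>

lemma integrable_exp_abs:
  assumes "integrable M (\<lambda>x. exp (S * x))" "integrable M (\<lambda>x. exp (- S * x))" "0 < S"
  shows "integrable M (\<lambda>x. exp (S * \<bar>x\<bar>))"
    and "expectation (\<lambda>x. exp (S * \<bar>x\<bar>))
      \<le> expectation (\<lambda>x. exp (S * x)) + expectation (\<lambda>x. exp (- S * x))"
proof -
  have le: "exp (S * \<bar>x\<bar>) \<le> exp (S * x) + exp (- S * x)" for x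
    by (cases "x \<ge> 0") auto
  show int: "integrable M (\<lambda>x. exp (S * \<bar>x\<bar>))"
  proof (rule Bochner_Integration.integrable_bound)
    show "integrable M (\<lambda>x. exp (S * x) + exp (- S * x))"
      using assms by auto
    show "AE x in M. norm (exp (S * \<bar>x\<bar>)) \<le> norm (exp (S * x) + exp (- S * x))"
      using le by (intro AE_I2) (simp add: add_pos_pos)
  qed simp
  have "expectation (\<lambda>x. exp (S * \<bar>x\<bar>)) \<le> expectation (\<lambda>x. exp (S * x) + exp (- S * x))"
    using assms int le by (intro integral_mono) auto
  then show "expectation (\<lambda>x. exp (S * \<bar>x\<bar>))
      \<le> expectation (\<lambda>x. exp (S * x)) + expectation (\<lambda>x. exp (- S * x))"
    using assms by simp
qed

text \<open>Rescales the disc of radius \<open>S\<close> to the unit disc, to match the range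
  \<open>0 < s < 1\<close> of the coefficient lemmas.\<close>

lemma sums_expectation_exp_scaled:
  fixes w :: complex
  assumes "integrable M (\<lambda>x. exp (S * \<bar>x\<bar>))" "0 < S" "norm w \<le> 1"
  shows "(\<lambda>k. of_real (expectation (\<lambda>x. x ^ k) / fact k * S ^ k) * w ^ k)
    sums (CLINT x|M. exp (of_real S * w * of_real x))"
proof -
  have "norm (of_real S * w) \<le> S"
    using assms by (simp add: norm_mult mult_left_le)
  from sums_expectation_exp[OF assms(1,2) this] show ?thesis
    by (simp add: power_mult_distrib mult.assoc)
qed

end

section \<open>Curtiss' theorem\<close>

text \<open>Integrability along the sequence is asked only eventually, from an index that may depend
  on \<open>s\<close>, because the log-Laplace limit controls each exponent only for large
  times.\<close>

theorem weak_conv_m_of_mgf_conv: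
  fixes \<mu> :: "nat \<Rightarrow> real measure" and \<nu> :: "real measure"
  assumes \<mu>: "\<And>n. real_distribution (\<mu> n)" and \<nu>: "real_distribution \<nu>"
    and int_\<mu>: "\<And>s. eventually (\<lambda>n. integrable (\<mu> n) (\<lambda>x. exp (s * x))) sequentially"
    and int_\<nu>: "\<And>s. integrable \<nu> (\<lambda>x. exp (s * x))"
    and lim: "\<And>s. (\<lambda>n. \<integral>x. exp (s * x) \<partial>\<mu> n) \<longlonglongrightarrow> (\<integral>x. exp (s * x) \<partial>\<nu>)"
  shows "weak_conv_m \<mu> \<nu>"
proof (rule levy_continuity[OF \<mu> \<nu>])
  fix t :: real
  interpret \<mu>: real_distribution "\<mu> n" for n by (rule \<mu>)
  interpret \<nu>: real_distribution \<nu> by (rule \<nu>)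
  \<comment> \<open>Strictly larger than \<open>\<bar>t\<bar>\<close>, so that
    \<open>\<i> * t\<close> becomes \<open>S * w\<close> with \<open>norm w < 1\<close>, and
    positive also for \<open>t = 0\<close>.\<close>
  define S where "S = \<bar>t\<bar> + 1"
  have S: "0 < S" "\<bar>t\<bar> < S"
    by (auto simp: S_def)
  define c where "c M k = (\<integral>x. x ^ k \<partial>M) / fact k * S ^ k" for M :: "real measure" and k
  define d where "d n k = c (\<mu> n) k - c \<nu> k" for n k
  define B where "B M = (\<integral>x. exp (S * x) \<partial>M) + (\<integral>x. exp (- S * x) \<partial>M)" for M :: "real measure"
  note abs_\<nu> = \<nu>.integrable_exp_abs[OF int_\<nu> int_\<nu> S(1)]
  have abs_\<mu>: "eventually (\<lambda>n. integrable (\<mu> n) (\<lambda>x. exp (S * \<bar>x\<bar>)) \<and>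
      (\<integral>x. exp (S * \<bar>x\<bar>) \<partial>\<mu> n) \<le> B \<nu> + 1) sequentially"
  proof -
    \<comment> \<open>Convergence at the two exponents \<open>S\<close> and \<open>- S\<close> alone
      already bounds the exponential moments uniformly in large \<open>n\<close>.\<close>
    have "(\<lambda>n. B (\<mu> n)) \<longlonglongrightarrow> B \<nu>"
      unfolding B_def by (intro tendsto_intros lim)
    then have "eventually (\<lambda>n. B (\<mu> n) < B \<nu> + 1) sequentially"
      by (rule order_tendstoD(2)) simp
    with int_\<mu>[of S] int_\<mu>[of "- S"] show ?thesis
    proof eventually_elim
      case (elim n)
      then show ?case
        using \<mu>.integrable_exp_abs[of n S] S(1) by (simp add: B_def)
    qed
  qed
  define C where "C = B \<nu> + 1 + B \<nu>"
  have bnd: "eventually (\<lambda>n. \<forall>k. \<bar>d n k\<bar> \<le> C) sequentially"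
    using abs_\<mu>
  proof eventually_elim
    case (elim n)
    show ?case
    proof
      fix k
      have "\<bar>c (\<mu> n) k\<bar> \<le> B \<nu> + 1"
        unfolding c_def using elim S(1) \<mu>.scaled_moment_le[of n S k] by linarith
      moreover have "\<bar>c \<nu> k\<bar> \<le> B \<nu>"
        unfolding c_def B_def using abs_\<nu> S(1) \<nu>.scaled_moment_le[of S k] by linarith
      ultimately show "\<bar>d n k\<bar> \<le> C"
        by (simp add: d_def C_def)
    qed
  qed
  \<comment> \<open>Used twice: at real \<open>s\<close> in the unit interval to find the
    coefficient limits, then at an imaginary point for the characteristic functions.\<close>
  have sums: "eventually (\<lambda>n. (\<lambda>k. of_real (d n k) * w ^ k) sums
      ((CLINT x|\<mu> n. exp (of_real S * w * of_real x))
        - (CLINT x|\<nu>. exp (of_real S * w * of_real x)))) sequentially"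
    if "norm w \<le> 1" for w :: complex
    using abs_\<mu>
  proof eventually_elim
    case (elim n)
    have "(\<lambda>k. of_real (c (\<mu> n) k) * w ^ k - of_real (c \<nu> k) * w ^ k) sums
        ((CLINT x|\<mu> n. exp (of_real S * w * of_real x))
          - (CLINT x|\<nu>. exp (of_real S * w * of_real x)))"
      unfolding c_def using elim abs_\<nu>(1) S(1) that
      by (intro sums_diff \<mu>.sums_expectation_exp_scaled \<nu>.sums_expectation_exp_scaled) auto
    then show ?case
      by (simp add: d_def left_diff_distrib)
  qed
  have d_lim: "(\<lambda>n. d n k) \<longlonglongrightarrow> 0" for k
  proof (rule coeff_tendsto_0_of_power_series_tendsto_0[OF bnd])
    fix s :: real
    assume s: "0 < s" "s < 1"
    have "norm (complex_of_real s) \<le> 1"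
      using s by simp
    from sums[OF this] have "eventually (\<lambda>n. (\<integral>x. exp (S * s * x) \<partial>\<mu> n) - (\<integral>x. exp (S * s * x) \<partial>\<nu>)
        = (\<Sum>k. d n k * s ^ k)) sequentially"
    proof eventually_elim
      case (elim n)
      have eq: "exp (of_real S * of_real s * of_real x) = complex_of_real (exp (S * s * x))" for x
        by (simp flip: exp_of_real)
      from elim have "(\<lambda>k. complex_of_real (d n k * s ^ k)) sums
          of_real ((\<integral>x. exp (S * s * x) \<partial>\<mu> n) - (\<integral>x. exp (S * s * x) \<partial>\<nu>))"
        unfolding eq integral_complex_of_real by simp
      then show ?case
        unfolding sums_of_real_iff by (rule sums_unique)
    qed
    moreover have "(\<lambda>n. (\<integral>x. exp (S * s * x) \<partial>\<mu> n) - (\<integral>x. exp (S * s * x) \<partial>\<nu>)) \<longlonglongrightarrow> 0"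
      using tendsto_diff[OF lim[of "S * s"] tendsto_const[of "\<integral>x. exp (S * s * x) \<partial>\<nu>"]] by simp
    ultimately show "(\<lambda>n. \<Sum>k. d n k * s ^ k) \<longlonglongrightarrow> 0"
      by (rule Lim_transform_eventually[rotated])
  qed
  define w where "w = \<i> * of_real (t / S)"
  have w: "norm w < 1"
    using S by (simp add: w_def norm_mult norm_divide)
  \<comment> \<open>Tannery's theorem exchanges limit and sum, with the summable majorant
    \<open>C * norm w ^ k\<close>.\<close>
  have "(\<lambda>n. \<Sum>k. of_real (d n k) * w ^ k) \<longlonglongrightarrow> (\<Sum>k. 0)"
  proof (rule tannerys_theorem[where M="\<lambda>k. C * norm w ^ k", THEN conjunct2, THEN conjunct2])
    show "(\<lambda>n. of_real (d n k) * w ^ k) \<longlonglongrightarrow> 0" for k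
      using tendsto_mult[OF tendsto_of_real[OF d_lim] tendsto_const] by simp
    show "eventually (\<lambda>(k, n). norm (of_real (d n k) * w ^ k) \<le> C * norm w ^ k)
        (at_top \<times>\<^sub>F sequentially)"
      using eventually_prodI[OF eventually_True bnd]
      by (rule eventually_mono)
        (auto simp: norm_mult norm_power intro!: mult_right_mono)
    show "summable (\<lambda>k. C * norm w ^ k)"
      using w by (intro summable_mult summable_geometric) simp
  qed simp
  moreover have "eventually (\<lambda>n. (\<Sum>k. of_real (d n k) * w ^ k) = char (\<mu> n) t - char \<nu> t) sequentially"
  proof -
    have "norm w \<le> 1" and w_eq: "of_real S * w = \<i> * of_real t"
      using w S(1) by (auto simp: w_def)
    from sums[OF this(1)] show ?thesis
    proof eventually_elim
      case (elim n)
      then show ?case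
        unfolding w_eq by (simp add: sums_iff char_def mult.assoc)
    qed
  qed
  ultimately have "(\<lambda>n. char (\<mu> n) t - char \<nu> t) \<longlonglongrightarrow> 0"
    using Lim_transform_eventually by fastforce
  then show "(\<lambda>n. char (\<mu> n) t) \<longlonglongrightarrow> char \<nu> t"
    by (simp add: LIM_zero_iff)
qed

section \<open>Moment generating functions of normal laws and of the normalized integrals\<close>

lemma normal_distribution_mgf:
  assumes "0 \<le> \<sigma>"
  shows "integrable (normal_distribution \<mu> \<sigma>) (\<lambda>x. exp (s * x))" (is ?int)
    and "(\<integral>x. exp (s * x) \<partial>normal_distribution \<mu> \<sigma>) = exp (s * \<mu> + s\<^sup>2 * \<sigma>\<^sup>2 / 2)" (is ?eq)
proof -
  have "?int \<and> ?eq"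
  proof (cases "\<sigma> = 0")
    case True
    have "integrable (return borel \<mu>) (\<lambda>x. exp (s * x))"
      by (subst integrable_iff_bounded) (auto simp: nn_integral_return)
    with True show ?thesis
      by (simp add: normal_distribution_def integral_return)
  next
    case False
    with assms have \<sigma>: "0 < \<sigma>"
      by simp
    \<comment> \<open>Completing the square: exponential tilting by \<open>s\<close> shifts the mean
      by \<open>s * \<sigma>\<^sup>2\<close> and leaves a normal density of total mass 1.\<close>
    have eq: "normal_density \<mu> \<sigma> x * exp (s * x)
        = exp (s * \<mu> + s\<^sup>2 * \<sigma>\<^sup>2 / 2) * normal_density (\<mu> + s * \<sigma>\<^sup>2) \<sigma> x" for x
    proof -
      have "- (x - \<mu>)\<^sup>2 / (2 * \<sigma>\<^sup>2) + s * x
          = (s * \<mu> + s\<^sup>2 * \<sigma>\<^sup>2 / 2) + - (x - (\<mu> + s * \<sigma>\<^sup>2))\<^sup>2 / (2 * \<sigma>\<^sup>2)"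
        using \<sigma> by (simp add: field_simps power2_eq_square)
      then show ?thesis
        unfolding normal_density_def by (simp add: mult_exp_exp mult.left_commute)
    qed
    show ?thesis
      using False \<sigma>
      by (simp add: normal_distribution_def integrable_density integral_density eq)
  qed
  then show ?int ?eq
    by auto
qed

text \<open>With \<open>\<theta> = s * r powr (- 1 / 2)\<close> the normalization
  \<open>r * \<theta>\<^sup>2\<close> is the constant \<open>s\<^sup>2\<close>, while
  \<open>\<bar>\<theta>\<bar> * ln r\<close> tends to 0, so \<open>\<theta>\<close> eventually
  enters the range of the log-Laplace limit.\<close>

lemma normalized_mgf_tendsto:
  assumes X: "random_process M X" and L: "log_mgf_limit M X L"
  shows "eventually (\<lambda>r. integrable M (\<lambda>\<omega>. exp (s * (r powr (- 1 / 2) * X 0 r \<omega>)))) at_top"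
      (is "eventually ?int at_top")
    and "((\<lambda>r. \<integral>\<omega>. exp (s * (r powr (- 1 / 2) * X 0 r \<omega>)) \<partial>M) \<longlongrightarrow> exp (s\<^sup>2 * L)) at_top"
      (is "(?E \<longlongrightarrow> _) _")
proof -
  interpret prob_space M
    using X by (simp add: random_process_def)
  have "eventually ?int at_top \<and> (?E \<longlongrightarrow> exp (s\<^sup>2 * L)) at_top"
  \<comment> \<open>The log-Laplace limit speaks only of nonzero \<open>\<theta>\<close>; for
    \<open>s = 0\<close> the integrand is constantly 1.\<close>
  proof (cases "s = 0")
    case True
    then show ?thesis
      by (simp add: prob_space)
  next
    case False
    have ev: "eventually (\<lambda>r. ?int r \<and> \<bar>ln (?E r) / s\<^sup>2 - L\<bar> \<le> \<epsilon>) at_top" if \<epsilon>: "0 < \<epsilon>" for \<epsilon>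
    proof -
      from L \<epsilon> obtain R \<delta> where R: "0 < R" "0 < \<delta>" and
        *: "\<And>r \<theta>. R \<le> r \<Longrightarrow> \<theta> \<noteq> 0 \<Longrightarrow> \<bar>\<theta>\<bar> * ln r \<le> \<delta> \<Longrightarrow>
            integrable M (\<lambda>\<omega>. exp (\<theta> * X 0 r \<omega>)) \<and>
            \<bar>1 / (r * \<theta>\<^sup>2) * ln (\<integral>\<omega>. exp (\<theta> * X 0 r \<omega>) \<partial>M) - L\<bar> \<le> \<epsilon>"
        unfolding log_mgf_limit_def by metis
      have "((\<lambda>r. \<bar>s\<bar> * (r powr (- 1 / 2) * ln r)) \<longlongrightarrow> \<bar>s\<bar> * 0) at_top"
        by (intro tendsto_mult tendsto_const) real_asymp
      then have "eventually (\<lambda>r. \<bar>s\<bar> * (r powr (- 1 / 2) * ln r) < \<delta>) at_top"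
        using R(2) by (intro order_tendstoD(2)) auto
      then show ?thesis
        using eventually_ge_at_top[of R]
      proof eventually_elim
        case (elim r)
        have r: "0 < r"
          using elim R by simp
        have "r * (s * r powr (- 1 / 2))\<^sup>2 = s\<^sup>2 * (r powr 1 * (r powr (- 1 / 2) * r powr (- 1 / 2)))"
          using r by (simp add: power2_eq_square)
        also have "\<dots> = s\<^sup>2"
          using r by (simp flip: powr_add)
        finally have sq: "r * (s * r powr (- 1 / 2))\<^sup>2 = s\<^sup>2" .
        show ?case
          using *[of r "s * r powr (- 1 / 2)"] elim r False
          unfolding sq by (simp add: abs_mult mult.assoc)
      qed
    qed
    have int: "eventually ?int at_top"
      using ev[OF zero_less_one] by eventually_elim auto
    have "((\<lambda>r. ln (?E r) / s\<^sup>2) \<longlongrightarrow> L) at_top"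
    proof (rule tendstoI)
      fix \<epsilon> :: real
      assume "0 < \<epsilon>"
      then have "eventually (\<lambda>r. ?int r \<and> \<bar>ln (?E r) / s\<^sup>2 - L\<bar> \<le> \<epsilon> / 2) at_top"
        by (intro ev) simp
      then show "eventually (\<lambda>r. dist (ln (?E r) / s\<^sup>2) L < \<epsilon>) at_top"
        by eventually_elim (use \<open>0 < \<epsilon>\<close> in \<open>simp add: dist_real_def\<close>)
    qed
    then have "((\<lambda>r. exp (s\<^sup>2 * (ln (?E r) / s\<^sup>2))) \<longlongrightarrow> exp (s\<^sup>2 * L)) at_top"
      by (intro tendsto_intros)
    moreover have "eventually (\<lambda>r. exp (s\<^sup>2 * (ln (?E r) / s\<^sup>2)) = ?E r) at_top"
      using int
    proof eventually_elim
      case (elim r)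
      \<comment> \<open>Undoing \<open>ln\<close> needs a positive argument. A vanishing integral of
        this integrable positive function would make it 0 almost everywhere, impossible on a
        probability space.\<close>
      have "?E r \<noteq> 0"
        using integral_nonneg_eq_0_iff_AE[OF elim] by (simp add: AE_False)
      then have "0 < ?E r"
        by (simp add: less_le)
      then show ?case
        using False by simp
    qed
    ultimately show ?thesis
      using int by (simp add: tendsto_cong)
  qed
  then show "eventually ?int at_top" "(?E \<longlongrightarrow> exp (s\<^sup>2 * L)) at_top"
    by auto
qed

section \<open>The central limit theorem\<close>

theorem corollary1p8:
  fixes M :: "'a measure" and X :: "'a process" and \<sigma> :: real
  assumes "splittable TYPE('b) M X"
    and "\<sigma> \<ge> 0"
    and "log_mgf_limit M X (\<sigma>\<^sup>2 / 2)"
  shows "weakly_converges (\<lambda>r. distr M borel (\<lambda>\<omega>. r powr (- 1 / 2) * X 0 r \<omega>))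
           (normal_distribution 0 \<sigma>) at_top"
proof -
  have X: "random_process M X"
    using assms(1) by (simp add: splittable_def)
  then interpret prob_space M
    by (simp add: random_process_def)
  have meas: "X 0 r \<in> borel_measurable M" if "0 < r" for r
    using X that by (simp add: random_process_def)
  define \<nu> where "\<nu> r = distr M borel (\<lambda>\<omega>. r powr (- 1 / 2) * X 0 r \<omega>)" for r
  have "((\<lambda>r. \<integral>x. f x \<partial>\<nu> r) \<longlongrightarrow> (\<integral>x. f x \<partial>normal_distribution 0 \<sigma>)) at_top"
    if f: "continuous_on UNIV f" "bounded (range f)" for f :: "real \<Rightarrow> real"
  \<comment> \<open>Curtiss' theorem was proved for sequences, so the continuous parameter is tested
    along arbitrary sequences tending to infinity.\<close>
  proof (rule tendsto_at_topI_sequentially)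
    fix r :: "nat \<Rightarrow> real"
    assume r: "filterlim r at_top sequentially"
    \<comment> \<open>\<open>X 0 u\<close> is junk, possibly not measurable, for \<open>u \<le> 0\<close>\<close>
    define q where "q n = max 1 (r n)" for n
    have pos: "0 < q n" for n
      by (simp add: q_def)
    note [measurable] = meas[OF pos]
    have q: "filterlim q at_top sequentially"
      by (rule filterlim_at_top_mono[OF r]) (simp add: q_def)
    have dist: "real_distribution (\<nu> (q n))" for n
      unfolding \<nu>_def by (intro real_distribution_distr) measurable
    have "weak_conv_m (\<lambda>n. \<nu> (q n)) (normal_distribution 0 \<sigma>)"
    proof (rule weak_conv_m_of_mgf_conv[OF dist real_distribution_normal_distribution[OF assms(2)]])
      fix s :: real
      note mgf = normalized_mgf_tendsto[OF X assms(3), of s]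
      have "eventually (\<lambda>n. integrable M (\<lambda>\<omega>. exp (s * (q n powr (- 1 / 2) * X 0 (q n) \<omega>)))) sequentially"
        using eventually_compose_filterlim[OF mgf(1) q] .
      then show "eventually (\<lambda>n. integrable (\<nu> (q n)) (\<lambda>x. exp (s * x))) sequentially"
        by eventually_elim (simp add: \<nu>_def integrable_distr_eq)
      show "integrable (normal_distribution 0 \<sigma>) (\<lambda>x. exp (s * x))"
        using assms(2) by (rule normal_distribution_mgf)
      \<comment> \<open>With \<open>L = \<sigma>\<^sup>2 / 2\<close> the limit
        \<open>exp (s\<^sup>2 * L)\<close> is the moment generating function of the centered normal
        law, also when \<open>\<sigma> = 0\<close>.\<close>
      show "(\<lambda>n. \<integral>x. exp (s * x) \<partial>\<nu> (q n)) \<longlonglongrightarrow> (\<integral>x. exp (s * x) \<partial>normal_distribution 0 \<sigma>)"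
        using filterlim_compose[OF mgf(2) q] assms(2)
        by (simp add: \<nu>_def integral_distr normal_distribution_mgf)
    qed
    then have "weakly_converges (\<lambda>n. \<nu> (q n)) (normal_distribution 0 \<sigma>) sequentially"
      using weakly_converges_sequentially_iff[OF dist real_distribution_normal_distribution[OF assms(2)]]
      by simp
    then have "(\<lambda>n. \<integral>x. f x \<partial>\<nu> (q n)) \<longlonglongrightarrow> (\<integral>x. f x \<partial>normal_distribution 0 \<sigma>)"
      using f by (simp add: weakly_converges_def)
    \<comment> \<open>The truncation at 1 is invisible in the limit: \<open>q n = r n\<close> once
      \<open>r n \<ge> 1\<close>.\<close>
    moreover have "eventually (\<lambda>n. (\<integral>x. f x \<partial>\<nu> (q n)) = (\<integral>x. f x \<partial>\<nu> (r n))) sequentially"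
      using filterlim_at_top[THEN iffD1, OF r, rule_format, of 1]
      by eventually_elim (simp add: q_def max_def)
    ultimately show "(\<lambda>n. \<integral>x. f x \<partial>\<nu> (r n)) \<longlonglongrightarrow> (\<integral>x. f x \<partial>normal_distribution 0 \<sigma>)"
      by (rule Lim_transform_eventually)
  qed
  then show ?thesis
    unfolding weakly_converges_def \<nu>_def by blast
qed

end
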